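(* Let $\mathcal{A}$ be a variety of $\Omega$-groups and $\mathcal{B}\le\mathcal{A}$ a subvariety. For any $\Omega$-group $A\in\mathcal{A}$ and ideals $M,N,N'$ of $A$, one has: 1. $[A,A]_{\mathcal{B}}=\{1\}$ if and only if $A\in\mathcal{B}$; 2. $[M,N]_{\mathcal{B}}=[N,M]_{\mathcal{B}}$; 3. $[M,N]_{\mathcal{B}}\le M\wedge N$; 4. if $N\le N'$ then $[M,N]_{\mathcal{B}}\le[M,N']_{\mathcal{B}}$; 5. (universal property) if $H=M\vee N$ and $q:H\to H/[M,N]_{\mathcal{B}}$ is the canonical quotient, then $[q(M),q(N)]_{\mathcal{B}}=\{1\}$, where $q(M)$ and $q(N)$ denote the direct images of $M$ and $N$ along $q$; moreover, $[M,N]_{\mathcal{B}}$ is the smallest ideal $I$ of $H$ such that the canonical quotient $q_I:H\to H/I$ has this property, i.e. $[q_I(M),q_I(N)]_{\mathcal{B}}=\{1\}$.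
   Context: A variety of $\Omega$-groups is a variety of universal algebras which has amongst its operations and identities those of the variety of groups but has no more than one constant (the unit $1$); thus $\{1\}$ is a subalgebra of every algebra, i.e. every operation $\omega$ satisfies $\omega(1,\dots,1)=1$. Its algebras are called $\Omega$-groups. An ideal of an $\Omega$-group $A$ is a subalgebra of $A$ that is the kernel of some homomorphism $A\to B$ in $\mathcal{A}$; for an ideal $N$ the quotient set $A/N$ carries a canonical $\Omega$-group structure. For subalgebras $M,N$ of $A$, $M\vee N$ is the subalgebra generated by $M\cup N$, $M\wedge N$ is the intersection, and $\le$ denotes inclusion. Bold letters denote finite tuples; for tuples $\mathbf{x}=(x_1,\dots,x_r)$, $\mathbf{y}=(y_1,\dots,y_r)$ write $\mathbf{x}\mathbf{y}=(x_1y_1,\dots,x_ry_r)$, and $\mathbf{m}\in M$ means that all entries of $\mathbf{m}$ lie in $M$. Let $W=W_{\mathcal{B}}=\{v(\mathbf{x}) \mid v(\mathbf{b})=1 \text{ for all } B\in\mathcal{B} \text{ and all } \mathbf{b}\in B\}$, a set of terms, i.e. of elements of the free $\Omega$-group $F_{\mathcal{A}}(\mathbb{N})$ of $\mathcal{A}$ on a countable set. For $A\in\mathcal{A}$ and ideals $M,N$ of $A$, the commutator $[M,N]_{\mathcal{B}}$ is the ideal of $M\vee N$ generated by the set $$\{v(\mathbf{m}\mathbf{n})v(\mathbf{n})^{-1}v(\mathbf{m})^{-1},\ v(\mathbf{p}) \mid v\in W,\ \mathbf{m}\in M,\ \mathbf{n}\in N,\ \mathbf{p}\in M\wedge N\}.$$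 *)

theory Defs
  imports Main "HOL.Hull"
begin

section \<open>Signatures, terms and algebras\<close>

text \<open>The operation symbols are all the elements of the type \<open>'f\<close>; three of them are singled out
  as the group operations.\<close>

record 'f omega_sig =
  arity :: "'f \<Rightarrow> nat"
  one_sym :: 'f
  mult_sym :: 'f
  inv_sym :: 'f

datatype 'f trm = Var nat | App 'f "'f trm list"

fun wf_trm :: "'f omega_sig \<Rightarrow> 'f trm \<Rightarrow> bool" where
  "wf_trm S (Var i) \<longleftrightarrow> True"
| "wf_trm S (App f ts) \<longleftrightarrow> length ts = arity S f \<and> (\<forall>t\<in>set ts. wf_trm S t)"

record ('f, 'a) alg =
  carrier :: "'a set"
  interp :: "'f \<Rightarrow> 'a list \<Rightarrow> 'a"

definition algebra :: "'f omega_sig \<Rightarrow> ('f, 'a) alg \<Rightarrow> bool" where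
  "algebra S A \<longleftrightarrow>
     (\<forall>f xs. length xs = arity S f \<longrightarrow> set xs \<subseteq> carrier A \<longrightarrow> interp A f xs \<in> carrier A)"

text \<open>A tuple of elements substituted into a term is a sequence \<open>nat \<Rightarrow> 'a\<close>, of which only the
  finitely many entries indexed by variables of the term matter.\<close>

fun eval :: "('f, 'a) alg \<Rightarrow> (nat \<Rightarrow> 'a) \<Rightarrow> 'f trm \<Rightarrow> 'a" where
  "eval A b (Var i) = b i"
| "eval A b (App f ts) = interp A f (map (eval A b) ts)"

definition one_of :: "'f omega_sig \<Rightarrow> ('f, 'a) alg \<Rightarrow> 'a" where
  "one_of S A = interp A (one_sym S) []"

definition mult_of :: "'f omega_sig \<Rightarrow> ('f, 'a) alg \<Rightarrow> 'a \<Rightarrow> 'a \<Rightarrow> 'a" where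
  "mult_of S A x y = interp A (mult_sym S) [x, y]"

definition inv_of :: "'f omega_sig \<Rightarrow> ('f, 'a) alg \<Rightarrow> 'a \<Rightarrow> 'a" where
  "inv_of S A x = interp A (inv_sym S) [x]"

definition hom :: "'f omega_sig \<Rightarrow> ('f, 'a) alg \<Rightarrow> ('f, 'b) alg \<Rightarrow> ('a \<Rightarrow> 'b) set" where
  "hom S A B = {h. h ` carrier A \<subseteq> carrier B \<and>
     (\<forall>f xs. length xs = arity S f \<longrightarrow> set xs \<subseteq> carrier A \<longrightarrow>
        h (interp A f xs) = interp B f (map h xs))}"

definition subalgebra :: "'f omega_sig \<Rightarrow> ('f, 'a) alg \<Rightarrow> 'a set \<Rightarrow> bool" where
  "subalgebra S A H \<longleftrightarrow> H \<subseteq> carrier A \<and>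
     (\<forall>f xs. length xs = arity S f \<longrightarrow> set xs \<subseteq> H \<longrightarrow> interp A f xs \<in> H)"

definition subalg :: "('f, 'a) alg \<Rightarrow> 'a set \<Rightarrow> ('f, 'a) alg" where
  "subalg A H = A\<lparr>carrier := H\<rparr>"

definition join :: "'f omega_sig \<Rightarrow> ('f, 'a) alg \<Rightarrow> 'a set \<Rightarrow> 'a set \<Rightarrow> 'a set" where
  "join S A M N = subalgebra S A hull (M \<union> N)"


section \<open>Varieties of Omega-groups\<close>

type_synonym 'f identities = "('f trm \<times> 'f trm) set"

definition identities_over :: "'f omega_sig \<Rightarrow> 'f identities \<Rightarrow> bool" where
  "identities_over S E \<longleftrightarrow> (\<forall>(s, t)\<in>E. wf_trm S s \<and> wf_trm S t)"

definition satisfies :: "('f, 'a) alg \<Rightarrow> 'f trm \<Rightarrow> 'f trm \<Rightarrow> bool" where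
  "satisfies A s t \<longleftrightarrow> (\<forall>b. range b \<subseteq> carrier A \<longrightarrow> eval A b s = eval A b t)"

definition in_variety :: "'f omega_sig \<Rightarrow> 'f identities \<Rightarrow> ('f, 'a) alg \<Rightarrow> bool" where
  "in_variety S E A \<longleftrightarrow> algebra S A \<and> (\<forall>(s, t)\<in>E. satisfies A s t)"

text \<open>A definition cannot quantify over algebras of all types at once. Wherever ``all algebras of
  the variety'' are meant, the carriers are subsets of the type \<open>'f trm set\<close>. This is no
  restriction: an identity valid in these algebras is valid in those of every type, see
  \<open>variety_identities_any_type\<close>, \<open>subvariety_any_type\<close> and \<open>trivial_terms_any_type\<close> below.\<close>

definition variety_identities :: "'f omega_sig \<Rightarrow> 'f identities \<Rightarrow> 'f identities" where
  "variety_identities S E = {(s, t). wf_trm S s \<and> wf_trm S t \<and>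
     (\<forall>A :: ('f, 'f trm set) alg. in_variety S E A \<longrightarrow> satisfies A s t)}"

definition group_identities :: "'f omega_sig \<Rightarrow> 'f identities" where
  "group_identities S =
    (let e = App (one_sym S) []; m = (\<lambda>s t. App (mult_sym S) [s, t]); i = (\<lambda>t. App (inv_sym S) [t]);
         x = Var 0; y = Var 1; z = Var 2
     in {(m (m x y) z, m x (m y z)), (m e x, x), (m x e, x), (m (i x) x, e), (m x (i x), e)})"

text \<open>\<open>\<omega>(1,\<dots>,1) = 1\<close> for every operation; for nullary \<open>\<omega>\<close> this says \<open>\<omega> = 1\<close>.\<close>

definition unit_identities :: "'f omega_sig \<Rightarrow> 'f identities" where
  "unit_identities S =
     range (\<lambda>f. (App f (replicate (arity S f) (App (one_sym S) [])), App (one_sym S) []))"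

definition omega_group_variety :: "'f omega_sig \<Rightarrow> 'f identities \<Rightarrow> bool" where
  "omega_group_variety S E \<longleftrightarrow>
     arity S (one_sym S) = 0 \<and> arity S (mult_sym S) = 2 \<and> arity S (inv_sym S) = 1 \<and>
     identities_over S E \<and>
     group_identities S \<union> unit_identities S \<subseteq> variety_identities S E"

definition subvariety :: "'f omega_sig \<Rightarrow> 'f identities \<Rightarrow> 'f identities \<Rightarrow> bool" where
  "subvariety S EB EA \<longleftrightarrow> identities_over S EB \<and>
     (\<forall>B :: ('f, 'f trm set) alg. in_variety S EB B \<longrightarrow> in_variety S EA B)"


section \<open>Ideals and quotients\<close>

definition ker :: "'f omega_sig \<Rightarrow> ('f, 'a) alg \<Rightarrow> ('f, 'b) alg \<Rightarrow> ('a \<Rightarrow> 'b) \<Rightarrow> 'a set" where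
  "ker S A B h = {a \<in> carrier A. h a = one_of S B}"

text \<open>The codomains range over algebras on subsets of \<open>'a set\<close>, where the quotients of \<open>A\<close> live;
  homomorphisms into algebras of any other type have no further kernels,
  see \<open>kernel_is_ideal\<close> below.\<close>

definition omega_ideal ::
  "'f omega_sig \<Rightarrow> 'f identities \<Rightarrow> ('f, 'a) alg \<Rightarrow> 'a set \<Rightarrow> bool" where
  "omega_ideal S E A N \<longleftrightarrow> subalgebra S A N \<and>
     (\<exists>B :: ('f, 'a set) alg. in_variety S E B \<and> (\<exists>h\<in>hom S A B. N = ker S A B h))"

definition ideal_rel :: "'f omega_sig \<Rightarrow> ('f, 'a) alg \<Rightarrow> 'a set \<Rightarrow> ('a \<times> 'a) set" where
  "ideal_rel S A N = {(a, b) \<in> carrier A \<times> carrier A. mult_of S A a (inv_of S A b) \<in> N}"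

definition quot_map :: "'f omega_sig \<Rightarrow> ('f, 'a) alg \<Rightarrow> 'a set \<Rightarrow> 'a \<Rightarrow> 'a set" where
  "quot_map S A N a = ideal_rel S A N `` {a}"

text \<open>For an ideal \<open>N\<close> the union in the operations is over copies of one and the same class.\<close>

definition quot_alg :: "'f omega_sig \<Rightarrow> ('f, 'a) alg \<Rightarrow> 'a set \<Rightarrow> ('f, 'a set) alg" where
  "quot_alg S A N =
     \<lparr>carrier = carrier A // ideal_rel S A N,
      interp = (\<lambda>f Xs. \<Union>{quot_map S A N (interp A f xs) | xs. list_all2 (\<in>) xs Xs})\<rparr>"


section \<open>The relative commutator\<close>

text \<open>The set \<open>W\<close> of terms which are trivial in the subvariety given by \<open>EB\<close>.\<close>

definition trivial_terms :: "'f omega_sig \<Rightarrow> 'f identities \<Rightarrow> 'f trm set" where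
  "trivial_terms S EB = {v. wf_trm S v \<and>
     (\<forall>B :: ('f, 'f trm set) alg. in_variety S EB B \<longrightarrow>
        (\<forall>b. range b \<subseteq> carrier B \<longrightarrow> eval B b v = one_of S B))}"

definition commutator_gens ::
  "'f omega_sig \<Rightarrow> 'f identities \<Rightarrow> ('f, 'a) alg \<Rightarrow> 'a set \<Rightarrow> 'a set \<Rightarrow> 'a set" where
  "commutator_gens S EB A M N =
     {mult_of S A (mult_of S A (eval A (\<lambda>i. mult_of S A (m i) (n i)) v) (inv_of S A (eval A n v)))
        (inv_of S A (eval A m v)) | v m n.
        v \<in> trivial_terms S EB \<and> range m \<subseteq> M \<and> range n \<subseteq> N}
     \<union> {eval A p v | v p. v \<in> trivial_terms S EB \<and> range p \<subseteq> M \<inter> N}"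

definition commutator ::
  "'f omega_sig \<Rightarrow> 'f identities \<Rightarrow> 'f identities \<Rightarrow> ('f, 'a) alg \<Rightarrow> 'a set \<Rightarrow> 'a set \<Rightarrow> 'a set" where
  "commutator S EA EB A M N =
     omega_ideal S EA (subalg A (join S A M N)) hull commutator_gens S EB A M N"


section \<open>The choice of types is immaterial\<close>

lemma eval_in_sub:
  assumes "subalgebra S A H" "wf_trm S t" "range b \<subseteq> H"
  shows "eval A b t \<in> H"
  using assms(2)
proof (induction t)
  case (Var i)
  then show ?case using assms(3) by auto
next
  case (App f ts)
  have "set (map (eval A b) ts) \<subseteq> H" using App by auto
  then show ?case using assms(1) App.prems unfolding subalgebra_def by simp
qed

lemma subalgebra_transport:
  fixes A :: "('f, 'a) alg" and K :: "'a \<Rightarrow> 'c"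
  assumes sub: "subalgebra S A H" and inj: "inj_on K H"
    and E: "identities_over S E" and A: "in_variety S E A"
  obtains B :: "('f, 'c) alg" where
    "carrier B = K ` H" "in_variety S E B"
    "\<And>f xs. length xs = arity S f \<Longrightarrow> set xs \<subseteq> H \<Longrightarrow> K (interp A f xs) = interp B f (map K xs)"
    "\<And>b t. range b \<subseteq> H \<Longrightarrow> wf_trm S t \<Longrightarrow> eval B (K \<circ> b) t = K (eval A b t)"
proof -
  define \<phi> where "\<phi> = inv_into H K"
  have \<phi>K: "\<phi> (K x) = x" if "x \<in> H" for x using inj that by (simp add: \<phi>_def)
  define B :: "('f, 'c) alg" where
    "B = \<lparr>carrier = K ` H, interp = (\<lambda>f xs. K (interp A f (map \<phi> xs)))\<rparr>"
  have cB: "carrier B = K ` H" by (simp add: B_def)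
  have op: "K (interp A f xs) = interp B f (map K xs)"
    if "set xs \<subseteq> H" for f xs
  proof -
    have "map (\<phi> \<circ> K) xs = xs" using that \<phi>K by (intro map_idI) auto
    then show ?thesis by (simp add: B_def)
  qed
  have ev: "eval B (K \<circ> b) t = K (eval A b t)" if b: "range b \<subseteq> H" and "wf_trm S t" for b t
    using that(2)
  proof (induction t)
    case (App f ts)
    have "map (eval B (K \<circ> b)) ts = map K (map (eval A b) ts)"
      using App by (simp add: list.map_comp del: comp_apply) (simp add: comp_def)
    moreover have "set (map (eval A b) ts) \<subseteq> H" using App.prems eval_in_sub[OF sub _ b] by auto
    ultimately show ?case by (simp only: eval.simps op)
  qed simp
  have algB: "algebra S B" unfolding algebra_def
  proof (intro allI impI)
    fix f xs assume len: "length xs = arity S f" and "set xs \<subseteq> carrier B"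
    then have "set (map \<phi> xs) \<subseteq> H" using \<phi>K by (auto simp: cB)
    then have "interp A f (map \<phi> xs) \<in> H" using sub len by (simp add: subalgebra_def)
    then show "interp B f xs \<in> carrier B" by (simp add: B_def)
  qed
  have "satisfies B s t" if st: "(s, t) \<in> E" for s t unfolding satisfies_def
  proof (intro allI impI)
    fix c :: "nat \<Rightarrow> 'c" assume c: "range c \<subseteq> carrier B"
    have ci: "c i \<in> K ` H" for i using c by (auto simp: cB)
    have b: "range (\<phi> \<circ> c) \<subseteq> H"
      using ci by (auto simp: \<phi>_def intro: inv_into_into)
    have cb: "K \<circ> (\<phi> \<circ> c) = c"
      using ci by (intro ext) (simp add: \<phi>_def f_inv_into_f)
    have wf: "wf_trm S s" "wf_trm S t" using E st by (auto simp: identities_over_def)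
    have "range (\<phi> \<circ> c) \<subseteq> carrier A" using b sub by (auto simp: subalgebra_def)
    then have "eval A (\<phi> \<circ> c) s = eval A (\<phi> \<circ> c) t"
      using A st by (auto simp: in_variety_def satisfies_def)
    then show "eval B c s = eval B c t" using ev[OF b wf(1)] ev[OF b wf(2)] by (simp only: cb)
  qed
  then have "in_variety S E B" using algB by (auto simp: in_variety_def)
  then show thesis using that[of B] cB op ev by blast
qed

theorem variety_identities_any_type:
  fixes A :: "('f, 'a) alg"
  assumes E: "identities_over S E" and st: "(s, t) \<in> variety_identities S E"
    and A: "in_variety S E A"
  shows "satisfies A s t"
  unfolding satisfies_def
proof (intro allI impI)
  fix b :: "nat \<Rightarrow> 'a" assume b: "range b \<subseteq> carrier A"
  define H where "H = {eval A b u | u. wf_trm S u}"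
  define K where "K a = {u. wf_trm S u \<and> eval A b u = a}" for a
  have car: "subalgebra S A (carrier A)"
    using A by (simp add: in_variety_def algebra_def subalgebra_def)
  have "interp A f xs \<in> H" if "length xs = arity S f" "set xs \<subseteq> H" for f xs
  proof -
    have "\<forall>x\<in>set xs. \<exists>u. wf_trm S u \<and> eval A b u = x" using that(2) by (auto simp: H_def)
    then obtain g where g: "\<forall>x\<in>set xs. wf_trm S (g x) \<and> eval A b (g x) = x" by metis
    have "map (\<lambda>x. eval A b (g x)) xs = xs" using g by (intro map_idI) auto
    then have "eval A b (App f (map g xs)) = interp A f xs" by (simp add: comp_def)
    moreover have "wf_trm S (App f (map g xs))" using g that(1) by auto
    ultimately show ?thesis unfolding H_def by (metis (mono_tags, lifting) mem_Collect_eq)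
  qed
  then have sub: "subalgebra S A H"
    using eval_in_sub[OF car _ b] by (auto simp: subalgebra_def H_def)
  have inj: "inj_on K H" by (rule inj_onI) (auto simp: H_def K_def)
  obtain B :: "('f, 'f trm set) alg" where B: "carrier B = K ` H" "in_variety S E B"
    "\<And>b t. range b \<subseteq> H \<Longrightarrow> wf_trm S t \<Longrightarrow> eval B (K \<circ> b) t = K (eval A b t)"
    using subalgebra_transport[OF sub inj E A] by metis
  have wf: "wf_trm S s" "wf_trm S t" and sat: "satisfies B s t"
    using st B(2) by (auto simp: variety_identities_def)
  have "b i \<in> H" for i
    unfolding H_def by (rule CollectI, rule exI[of _ "Var i"]) simp
  then have bH: "range b \<subseteq> H" by auto
  then have "range (K \<circ> b) \<subseteq> carrier B" by (auto simp: B(1))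
  then have "eval B (K \<circ> b) s = eval B (K \<circ> b) t" using sat unfolding satisfies_def by blast
  then have "K (eval A b s) = K (eval A b t)" using B(3)[OF bH] wf by simp
  then show "eval A b s = eval A b t"
    using inj eval_in_sub[OF sub _ bH] wf by (auto dest: inj_onD)
qed

theorem subvariety_any_type:
  fixes B :: "('f, 'a) alg"
  assumes "subvariety S EB EA" "identities_over S EA" "in_variety S EB B"
  shows "in_variety S EA B"
proof -
  have "(s, t) \<in> variety_identities S EB" if "(s, t) \<in> EA" for s t
    using assms that
    by (fastforce simp: variety_identities_def subvariety_def in_variety_def identities_over_def)
  then show ?thesis
    using assms variety_identities_any_type[of S EB _ _ B]
    by (auto simp: in_variety_def subvariety_def)
qed

theorem trivial_terms_any_type:
  fixes B :: "('f, 'a) alg"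
  assumes "arity S (one_sym S) = 0" "identities_over S EB" "v \<in> trivial_terms S EB"
    and "in_variety S EB B" "range b \<subseteq> carrier B"
  shows "eval B b v = one_of S B"
proof -
  have "(v, App (one_sym S) []) \<in> variety_identities S EB"
    using assms(1,3) by (auto simp: variety_identities_def trivial_terms_def satisfies_def one_of_def)
  from variety_identities_any_type[OF assms(2) this assms(4)] assms(5)
  show ?thesis by (auto simp: satisfies_def one_of_def)
qed

theorem kernel_is_ideal:
  fixes A :: "('f, 'a) alg" and B :: "('f, 'b) alg"
  assumes V: "omega_group_variety S E"
    and A: "in_variety S E A" and B: "in_variety S E B" and h: "h \<in> hom S A B"
  shows "omega_ideal S E A (ker S A B h)"
proof -
  let ?H = "h ` carrier A"
  define K where "K y = {a \<in> carrier A. h a = y}" for y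
  have E: "identities_over S E" and ar: "arity S (one_sym S) = 0"
    using V by (auto simp: omega_group_variety_def)
  have hop: "h (interp A f xs) = interp B f (map h xs)"
    if "length xs = arity S f" "set xs \<subseteq> carrier A" for f xs
    using h that by (auto simp: hom_def)
  have Aop: "interp A f xs \<in> carrier A"
    if "length xs = arity S f" "set xs \<subseteq> carrier A" for f xs
    using A that by (auto simp: in_variety_def algebra_def)
  have h1: "h (one_of S A) = one_of S B" and A1: "one_of S A \<in> carrier A"
    using hop[of "[]" "one_sym S"] Aop[of "[]" "one_sym S"] ar by (auto simp: one_of_def)
  have sub: "subalgebra S B ?H" unfolding subalgebra_def
  proof (intro conjI allI impI)
    show "?H \<subseteq> carrier B" using h by (auto simp: hom_def)
    fix f ys assume len: "length ys = arity S f" and "set ys \<subseteq> ?H"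
    then have "ys \<in> lists (h ` carrier A)" by auto
    then obtain xs where "set xs \<subseteq> carrier A" "ys = map h xs" by (auto simp: lists_image)
    then show "interp B f ys \<in> ?H" using hop[of xs f] Aop[of xs f] len by force
  qed
  have inj: "inj_on K ?H" by (rule inj_onI) (auto simp: K_def)
  obtain C :: "('f, 'a set) alg" where C: "carrier C = K ` ?H" "in_variety S E C"
    "\<And>f xs. length xs = arity S f \<Longrightarrow> set xs \<subseteq> ?H \<Longrightarrow> K (interp B f xs) = interp C f (map K xs)"
    using subalgebra_transport[OF sub inj E B] by metis
  have "K \<circ> h \<in> hom S A C" unfolding hom_def
  proof (intro CollectI conjI allI impI)
    show "(K \<circ> h) ` carrier A \<subseteq> carrier C" by (auto simp: C(1))
    fix f xs assume "length xs = arity S f" "set xs \<subseteq> carrier A"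
    then show "(K \<circ> h) (interp A f xs) = interp C f (map (K \<circ> h) xs)"
      using C(3)[of "map h xs" f] hop by (auto simp: image_mono)
  qed
  moreover have "ker S A B h = ker S A C (K \<circ> h)"
  proof -
    have "one_of S C = K (one_of S B)" using C(3)[of "[]" "one_sym S"] ar by (simp add: one_of_def)
    moreover have "K (h a) = K (one_of S B) \<longleftrightarrow> h a = one_of S B" if "a \<in> carrier A" for a
      using inj_on_eq_iff[OF inj, of "h a" "h (one_of S A)"] that A1 h1 by (metis imageI)
    ultimately show ?thesis by (auto simp: ker_def)
  qed
  moreover have "subalgebra S A (ker S A B h)" unfolding subalgebra_def
  proof (intro conjI allI impI)
    show "ker S A B h \<subseteq> carrier A" by (auto simp: ker_def)
    fix f xs assume len: "length xs = arity S f" and xs: "set xs \<subseteq> ker S A B h"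
    have "map h xs = replicate (arity S f) (one_of S B)"
      using xs len by (intro replicate_eqI) (auto simp: ker_def)
    moreover have "interp B f (replicate (arity S f) (one_of S B)) = one_of S B"
    proof -
      let ?e = "App (one_sym S) []"
      have "(App f (replicate (arity S f) ?e), ?e) \<in> variety_identities S E"
        using V by (auto simp: omega_group_variety_def unit_identities_def)
      then have "satisfies B (App f (replicate (arity S f) ?e)) ?e"
        using variety_identities_any_type[OF E _ B] by blast
      moreover have "range (\<lambda>_::nat. one_of S B) \<subseteq> carrier B" using h h1 A1 by (auto simp: hom_def)
      ultimately have "eval B (\<lambda>_. one_of S B) (App f (replicate (arity S f) ?e)) =
        eval B (\<lambda>_. one_of S B) ?e" unfolding satisfies_def by blast
      then show ?thesis by (simp add: one_of_def)
    qed
    moreover have "set xs \<subseteq> carrier A" using xs by (auto simp: ker_def)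
    ultimately show "interp A f xs \<in> ker S A B h"
      using hop[OF len] Aop[OF len] by (simp add: ker_def)
  qed
  ultimately show ?thesis using C(2) unfolding omega_ideal_def by blast
qed

end

theory Submission
  imports Defs
begin

text \<open>Ideals are the subalgebras whose associated relation is a congruence; hence they are closed
  under intersections and restrict to subalgebras, and the commutator is trivial exactly if its
  generators are. This reduces every claim except symmetry to a computation modulo an ideal.
  For symmetry one passes to the quotient by \<open>[M,N]\<close>. There, for a term \<open>v\<close> in \<open>W\<close>, applying the
  defining relations to the term \<open>z v z^{-1}\<close> of \<open>W\<close>, with a new variable \<open>z\<close>, shows that \<open>v(m)\<close>
  commutes with every element of \<open>N\<close>. Writing \<open>nmn^{-1} = mr\<close> with \<open>r\<close> in \<open>M \<and> N\<close>, one gets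
  \<open>v(nm) = v((mr)n) = v(m)v(r)v(n) = v(m)v(n) = v(n)v(m)\<close>.\<close>

section \<open>Terms, subalgebras and generators of the commutator\<close>

fun rename :: "(nat \<Rightarrow> nat) \<Rightarrow> 'f trm \<Rightarrow> 'f trm" where
  "rename g (Var i) = Var (g i)"
| "rename g (App f ts) = App f (map (rename g) ts)"

lemma wf_rename [simp]: "wf_trm S (rename g t) = wf_trm S t"
  by (induction t) auto

text \<open>Renaming serves to shift all variables by \<open>Suc\<close>, which frees
  \<open>Var 0\<close> for a new conjugating variable. The shifted term then evaluates to the value
  of the original term on the tail of the sequence.\<close>

lemma eval_rename [simp]: "eval A b (rename g t) = eval A (b \<circ> g) t"
  by (induction t) (auto simp: comp_def cong: map_cong)

lemma carrier_subalg [simp]: "carrier (subalg A H) = H"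
  by (simp add: subalg_def)

lemma interp_subalg [simp]: "interp (subalg A H) = interp A"
  by (simp add: subalg_def)

lemma subalg_carrier [simp]: "subalg A (carrier A) = A"
  by (simp add: subalg_def)

lemma subalg_subalg [simp]: "subalg (subalg A H) K = subalg A K"
  by (simp add: subalg_def)

lemma of_subalg [simp]:
  "one_of S (subalg A H) = one_of S A"
  "mult_of S (subalg A H) = mult_of S A"
  "inv_of S (subalg A H) = inv_of S A"
  by (auto simp: one_of_def mult_of_def inv_of_def fun_eq_iff)

lemma eval_subalg [simp]: "eval (subalg A H) = eval A"
proof (intro ext)
  show "eval (subalg A H) b t = eval A b t" for b t
    by (induction t) (auto cong: map_cong)
qed

text \<open>Only the carrier changes in \<open>subalg\<close>, and the generators refer to
  operations and given subsets alone. Thus they are the same whether computed in the whole algebra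
  or in the join, where the commutator is an ideal.\<close>

lemma commutator_gens_subalg [simp]:
  "commutator_gens S E (subalg A H) = commutator_gens S E A"
  by (intro ext) (simp add: commutator_gens_def)

text \<open>Non-emptiness guards against the empty intersection, which is the whole type rather than
  a subset of \<open>carrier A\<close>.\<close>

lemma subalgebra_Inter:
  "\<F> \<noteq> {} \<Longrightarrow> (\<And>H. H \<in> \<F> \<Longrightarrow> subalgebra S A H) \<Longrightarrow> subalgebra S A (\<Inter>\<F>)"
  unfolding subalgebra_def by blast

lemma hom_eval:
  assumes "algebra S A" "h \<in> hom S A B" "range b \<subseteq> carrier A" "wf_trm S t"
  shows "h (eval A b t) = eval B (h \<circ> b) t"
  using assms(4)
proof (induction t)
  case (App f ts)
  have "subalgebra S A (carrier A)"
    using assms(1) by (simp add: algebra_def subalgebra_def)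
  then have "set (map (eval A b) ts) \<subseteq> carrier A"
    using App.prems eval_in_sub[OF _ _ assms(3)] by auto
  then have "h (eval A b (App f ts)) = interp B f (map h (map (eval A b) ts))"
    using App.prems assms(2) by (simp add: hom_def)
  also have "map h (map (eval A b) ts) = map (eval B (h \<circ> b)) ts"
    using App by (simp del: comp_apply) (simp add: comp_def)
  finally show ?case by (simp only: eval.simps)
qed simp

lemma commutator_gensI:
  "v \<in> trivial_terms S E \<Longrightarrow> range m \<subseteq> M \<Longrightarrow> range n \<subseteq> N \<Longrightarrow>
    mult_of S A (mult_of S A (eval A (\<lambda>i. mult_of S A (m i) (n i)) v) (inv_of S A (eval A n v)))
      (inv_of S A (eval A m v)) \<in> commutator_gens S E A M N"
  "v \<in> trivial_terms S E \<Longrightarrow> range p \<subseteq> M \<inter> N \<Longrightarrow> eval A p v \<in> commutator_gens S E A M N"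
  unfolding commutator_gens_def
  by (rule UnI1, rule CollectI, intro exI conjI, rule refl, assumption+)
    (rule UnI2, rule CollectI, intro exI conjI, rule refl, assumption+)

lemma commutator_gensE [consumes 1, case_names mult int]:
  assumes "x \<in> commutator_gens S E A M N"
  obtains v m n where "v \<in> trivial_terms S E" "range m \<subseteq> M" "range n \<subseteq> N"
    "x = mult_of S A (mult_of S A (eval A (\<lambda>i. mult_of S A (m i) (n i)) v)
      (inv_of S A (eval A n v))) (inv_of S A (eval A m v))"
  | v p where "v \<in> trivial_terms S E" "range p \<subseteq> M \<inter> N" "x = eval A p v"
  using assms unfolding commutator_gens_def by (elim UnE CollectE exE conjE)

lemma commutator_gens_mono:
  assumes "M \<subseteq> M'" "N \<subseteq> N'"
  shows "commutator_gens S E A M N \<subseteq> commutator_gens S E A M' N'"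
proof
  show "x \<in> commutator_gens S E A M' N'" if "x \<in> commutator_gens S E A M N" for x
    using that
  proof (cases rule: commutator_gensE)
    case (mult v m n)
    then show ?thesis using assms by (auto intro!: commutator_gensI(1))
  next
    case (int v p)
    then show ?thesis using assms by (auto intro!: commutator_gensI(2))
  qed
qed

lemma join_commute: "join S A M N = join S A N M"
  by (simp add: join_def Un_commute)

lemma join_upper: "M \<subseteq> join S A M N" "N \<subseteq> join S A M N"
  unfolding join_def using hull_subset[of "M \<union> N" "subalgebra S A"] by auto

lemma join_least:
  "subalgebra S A H \<Longrightarrow> M \<subseteq> H \<Longrightarrow> N \<subseteq> H \<Longrightarrow> join S A M N \<subseteq> H"
  by (simp add: join_def hull_minimal)

lemma commutator_gens_subset_commutator:
  "commutator_gens S EB A M N \<subseteq> commutator S EA EB A M N"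
  by (simp add: commutator_def hull_subset)

lemma commutator_least:
  "omega_ideal S EA (subalg A (join S A M N)) I \<Longrightarrow> commutator_gens S EB A M N \<subseteq> I
    \<Longrightarrow> commutator S EA EB A M N \<subseteq> I"
  by (simp add: commutator_def hull_minimal)


section \<open>Group calculus inside an Omega-group\<close>

locale omega_group =
  fixes S :: "'f omega_sig" and E :: "'f identities" and A :: "('f, 'a) alg"
  assumes variety: "omega_group_variety S E" and in_variety: "in_variety S E A"
begin

abbreviation one ("\<one>") where "\<one> \<equiv> one_of S A"
abbreviation mult (infixl "\<cdot>" 70) where "x \<cdot> y \<equiv> mult_of S A x y"
abbreviation inv' ("\<sim> _" [81] 80) where "\<sim> x \<equiv> inv_of S A x"

lemma arity_simps [simp]:
    "arity S (one_sym S) = 0" "arity S (mult_sym S) = 2" "arity S (inv_sym S) = 1"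
  and identities: "identities_over S E"
  using variety by (auto simp: omega_group_variety_def)

lemma algebra: "algebra S A"
  using in_variety by (simp add: in_variety_def)

lemma subalgebra_carrier: "subalgebra S A (carrier A)"
  using algebra by (simp add: algebra_def subalgebra_def)

lemma interp_closed:
  "length xs = arity S f \<Longrightarrow> set xs \<subseteq> carrier A \<Longrightarrow> interp A f xs \<in> carrier A"
  using algebra by (simp add: algebra_def)

lemma eval_closed [simp]: "range b \<subseteq> carrier A \<Longrightarrow> wf_trm S t \<Longrightarrow> eval A b t \<in> carrier A"
  by (rule eval_in_sub[OF subalgebra_carrier])

lemma subalgebra_closed:
  assumes "subalgebra S A H"
  shows "\<one> \<in> H" "x \<in> H \<Longrightarrow> y \<in> H \<Longrightarrow> x \<cdot> y \<in> H" "x \<in> H \<Longrightarrow> \<sim> x \<in> H"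
  using assms by (auto simp: subalgebra_def one_of_def mult_of_def inv_of_def)

lemmas closed [simp, intro] = subalgebra_closed[OF subalgebra_carrier]

text \<open>Membership in \<open>variety_identities\<close> only speaks of algebras on
  \<open>'f trm set\<close>; \<open>variety_identities_any_type\<close> carries the identities over
  to the type of \<open>A\<close>.\<close>

lemma eval_eq:
  assumes "(s, t) \<in> group_identities S \<union> unit_identities S" "range b \<subseteq> carrier A"
  shows "eval A b s = eval A b t"
proof -
  have "(s, t) \<in> variety_identities S E"
    using assms(1) variety by (auto simp: omega_group_variety_def)
  then show ?thesis
    using variety_identities_any_type[OF identities _ in_variety] assms(2)
    unfolding satisfies_def by blast
qed

lemma group_laws:
  assumes "x \<in> carrier A" "y \<in> carrier A" "z \<in> carrier A"
  shows "x \<cdot> y \<cdot> z = x \<cdot> (y \<cdot> z)" "\<one> \<cdot> x = x" "x \<cdot> \<one> = x" "\<sim> x \<cdot> x = \<one>" "x \<cdot> \<sim> x = \<one>"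
proof -
  \<comment> \<open>The group identities use the variables 0, 1 and 2 only. All later variables also
    get the value \<open>z\<close>, since the range of the whole sequence must stay in the
    carrier.\<close>
  define b where "b = (\<lambda>i::nat. if i = 0 then x else if i = 1 then y else z)"
  have b: "range b \<subseteq> carrier A" using assms by (auto simp: b_def)
  note laws = group_identities_def Let_def b_def mult_of_def inv_of_def one_of_def
  show "x \<cdot> y \<cdot> z = x \<cdot> (y \<cdot> z)"
    using eval_eq[OF _ b, of "App (mult_sym S) [App (mult_sym S) [Var 0, Var 1], Var 2]"
      "App (mult_sym S) [Var 0, App (mult_sym S) [Var 1, Var 2]]"] by (simp add: laws)
  show "\<one> \<cdot> x = x"
    using eval_eq[OF _ b, of "App (mult_sym S) [App (one_sym S) [], Var 0]" "Var 0"]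
    by (simp add: laws)
  show "x \<cdot> \<one> = x"
    using eval_eq[OF _ b, of "App (mult_sym S) [Var 0, App (one_sym S) []]" "Var 0"]
    by (simp add: laws)
  show "\<sim> x \<cdot> x = \<one>"
    using eval_eq[OF _ b, of "App (mult_sym S) [App (inv_sym S) [Var 0], Var 0]"
      "App (one_sym S) []"] by (simp add: laws)
  show "x \<cdot> \<sim> x = \<one>"
    using eval_eq[OF _ b, of "App (mult_sym S) [Var 0, App (inv_sym S) [Var 0]]"
      "App (one_sym S) []"] by (simp add: laws)
qed

lemma assoc [simp]:
  "x \<in> carrier A \<Longrightarrow> y \<in> carrier A \<Longrightarrow> z \<in> carrier A \<Longrightarrow> x \<cdot> y \<cdot> z = x \<cdot> (y \<cdot> z)"
  by (rule group_laws)

lemma units [simp]: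
  assumes "x \<in> carrier A"
  shows "\<one> \<cdot> x = x" "x \<cdot> \<one> = x" "\<sim> x \<cdot> x = \<one>" "x \<cdot> \<sim> x = \<one>"
  by (rule group_laws[OF assms assms assms])+

lemma cancel [simp]:
  assumes "x \<in> carrier A" "y \<in> carrier A"
  shows "\<sim> x \<cdot> (x \<cdot> y) = y" "x \<cdot> (\<sim> x \<cdot> y) = y"
  using assms by (simp_all flip: assoc)

lemma inv_unique:
  assumes "x \<in> carrier A" "y \<in> carrier A" "x \<cdot> y = \<one>"
  shows "y = \<sim> x"
  using cancel(1)[OF assms(1,2)] assms by simp

lemma inv_inv [simp]: "x \<in> carrier A \<Longrightarrow> \<sim> (\<sim> x) = x"
  using inv_unique[of "\<sim> x" x] by simp

lemma inv_one [simp]: "\<sim> \<one> = \<one>"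
  using inv_unique[of \<one> \<one>] by simp

lemma inv_mult [simp]: "x \<in> carrier A \<Longrightarrow> y \<in> carrier A \<Longrightarrow> \<sim> (x \<cdot> y) = \<sim> y \<cdot> \<sim> x"
  using inv_unique[of "x \<cdot> y" "\<sim> y \<cdot> \<sim> x"] by simp

lemma mult_inv_eq_one_iff:
  assumes "x \<in> carrier A" "y \<in> carrier A"
  shows "x \<cdot> \<sim> y = \<one> \<longleftrightarrow> x = y"
  using inv_unique[of x "\<sim> y"] assms by (metis closed(3) inv_inv units(4))

text \<open>The left side has the shape of a generator, with \<open>x\<close>, \<open>y\<close>,
  \<open>z\<close> standing for v(mn), v(n), v(m). Its triviality thus becomes the multiplicativity
  law v(mn) = v(m)v(n).\<close>

lemma mult_inv_inv_eq_one_iff: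
  assumes "x \<in> carrier A" "y \<in> carrier A" "z \<in> carrier A"
  shows "x \<cdot> \<sim> y \<cdot> \<sim> z = \<one> \<longleftrightarrow> x = z \<cdot> y"
  using mult_inv_eq_one_iff[of x "z \<cdot> y"] assms by simp

lemma interp_one [simp]: "interp A f (replicate (arity S f) \<one>) = \<one>"
proof -
  have "eval A (\<lambda>_. \<one>) (App f (replicate (arity S f) (App (one_sym S) []))) =
      eval A (\<lambda>_. \<one>) (App (one_sym S) [])"
    by (rule eval_eq) (auto simp: unit_identities_def)
  then show ?thesis by (simp add: one_of_def)
qed

lemma eval_one [simp]: "wf_trm S t \<Longrightarrow> eval A (\<lambda>_. \<one>) t = \<one>"
proof (induction t)
  case (App f ts)
  then have "map (eval A (\<lambda>_. \<one>)) ts = replicate (arity S f) \<one>"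
    by (intro replicate_eqI) auto
  then show ?case by simp
qed simp

lemma in_variety_subalg:
  assumes "subalgebra S A H"
  shows "in_variety S E (subalg A H)"
proof -
  have "satisfies (subalg A H) s t" if "(s, t) \<in> E" for s t
  proof -
    have "satisfies A s t" using that in_variety by (auto simp: in_variety_def)
    then show ?thesis using assms by (auto simp: satisfies_def subalgebra_def)
  qed
  then show ?thesis using assms by (auto simp: in_variety_def algebra_def subalgebra_def)
qed

section \<open>Homomorphisms, ideals as congruences, and quotients\<close>

lemma hom_ops:
  assumes "h \<in> hom S A B"
  shows "h \<one> = one_of S B"
    "x \<in> carrier A \<Longrightarrow> y \<in> carrier A \<Longrightarrow> h (x \<cdot> y) = mult_of S B (h x) (h y)"
    "x \<in> carrier A \<Longrightarrow> h (\<sim> x) = inv_of S B (h x)"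
    "x \<in> carrier A \<Longrightarrow> h x \<in> carrier B"
  using assms by (auto simp: hom_def one_of_def mult_of_def inv_of_def)

lemma hom_commutator_gen:
  assumes "h \<in> hom S A B" "range m \<subseteq> carrier A" "range n \<subseteq> carrier A" "wf_trm S v"
  shows "h (eval A (\<lambda>i. m i \<cdot> n i) v \<cdot> \<sim> (eval A n v) \<cdot> \<sim> (eval A m v)) =
    mult_of S B (mult_of S B (eval B (\<lambda>i. mult_of S B (h (m i)) (h (n i))) v)
      (inv_of S B (eval B (h \<circ> n) v))) (inv_of S B (eval B (h \<circ> m) v))"
proof -
  have mn: "m i \<in> carrier A" "n i \<in> carrier A" for i using assms by auto
  then have r: "range (\<lambda>i. m i \<cdot> n i) \<subseteq> carrier A" by auto
  have "h \<circ> (\<lambda>i. m i \<cdot> n i) = (\<lambda>i. mult_of S B (h (m i)) (h (n i)))"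
    using hom_ops[OF assms(1)] mn by auto
  \<comment> \<open>Reassociation is switched off to preserve the left-nested bracketing in which
    both sides are stated.\<close>
  then show ?thesis
    using assms r by (simp add: hom_ops[OF assms(1)] hom_eval[OF algebra assms(1)] del: assoc)
qed

lemma subalgebra_image:
  assumes h: "h \<in> hom S A B" and H: "subalgebra S A H"
  shows "subalgebra S B (h ` H)"
  unfolding subalgebra_def
proof (intro conjI allI impI)
  have HA: "H \<subseteq> carrier A" using H by (simp add: subalgebra_def)
  then show "h ` H \<subseteq> carrier B" using h by (auto simp: hom_def)
  fix f ys assume len: "length ys = arity S f" and "set ys \<subseteq> h ` H"
  then have "ys \<in> lists (h ` H)" by auto
  then obtain xs where xs: "set xs \<subseteq> H" "ys = map h xs" by (auto simp: lists_image)
  have "h (interp A f xs) = interp B f ys"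
    using h xs len HA by (auto simp: hom_def)
  moreover have "interp A f xs \<in> H" using H xs len by (simp add: subalgebra_def)
  ultimately show "interp B f ys \<in> h ` H" by (metis imageI)
qed

text \<open>An internal description of ideals, free of homomorphisms and codomains. In this form
  stability under intersections is visible, and it is exactly what makes the operations on classes
  well defined.\<close>

definition congruence_ideal :: "'a set \<Rightarrow> bool" where
  "congruence_ideal N \<longleftrightarrow> subalgebra S A N \<and>
     (\<forall>f xs ys. length xs = arity S f \<longrightarrow> list_all2 (\<lambda>x y. (x, y) \<in> ideal_rel S A N) xs ys \<longrightarrow>
        (interp A f xs, interp A f ys) \<in> ideal_rel S A N)"

text \<open>In the group \<open>B\<close>, a product h(x)h(y)^{-1} is 1 exactly if h(x) = h(y).
  Hence the relation of an ideal is the kernel pair of any homomorphism of which it is the kernel,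
  and computing modulo the ideal means computing in \<open>B\<close>.\<close>

lemma omega_ideal_kernel:
  assumes "omega_ideal S E A N"
  obtains B :: "('f, 'a set) alg" and h where "omega_group S E B" "h \<in> hom S A B"
    "N = {a \<in> carrier A. h a = one_of S B}"
    "\<And>x y. (x, y) \<in> ideal_rel S A N \<longleftrightarrow> x \<in> carrier A \<and> y \<in> carrier A \<and> h x = h y"
proof -
  obtain B :: "('f, 'a set) alg" and h where B: "in_variety S E B" and h: "h \<in> hom S A B"
    and N: "N = {a \<in> carrier A. h a = one_of S B}"
    using assms by (auto simp: omega_ideal_def ker_def)
  interpret B: omega_group S E B using variety B by unfold_locales
  have "(x, y) \<in> ideal_rel S A N \<longleftrightarrow> x \<in> carrier A \<and> y \<in> carrier A \<and> h x = h y" for x y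
    using hom_ops[OF h] B.mult_inv_eq_one_iff by (auto simp: ideal_rel_def N)
  then show thesis using that B.omega_group_axioms h N by blast
qed

lemma omega_ideal_imp_congruence_ideal:
  assumes "omega_ideal S E A N"
  shows "congruence_ideal N"
proof -
  obtain B :: "('f, 'a set) alg" and h where h: "h \<in> hom S A B"
    and rel: "\<And>x y. (x, y) \<in> ideal_rel S A N \<longleftrightarrow> x \<in> carrier A \<and> y \<in> carrier A \<and> h x = h y"
    by (rule omega_ideal_kernel[OF assms]) (rule that)
  have "(interp A f xs, interp A f ys) \<in> ideal_rel S A N"
    if "length xs = arity S f" "list_all2 (\<lambda>x y. (x, y) \<in> ideal_rel S A N) xs ys" for f xs ys
  proof -
    have c: "set xs \<subseteq> carrier A" "set ys \<subseteq> carrier A" "length ys = arity S f"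
      and "map h xs = map h ys"
      using that by (auto simp: rel list_all2_conv_all_nth set_conv_nth intro: nth_equalityI)
    then have "h (interp A f xs) = h (interp A f ys)" using h that by (simp add: hom_def)
    then show ?thesis using c that interp_closed by (simp add: rel)
  qed
  then show ?thesis using assms by (simp add: congruence_ideal_def omega_ideal_def)
qed

lemma ideal_rel_equiv:
  assumes "subalgebra S A N"
  shows "equiv (carrier A) (ideal_rel S A N)"
proof (rule equivI)
  note N = subalgebra_closed[OF assms]
  show "ideal_rel S A N \<subseteq> carrier A \<times> carrier A" by (auto simp: ideal_rel_def)
  show "refl_on (carrier A) (ideal_rel S A N)"
    using N(1) by (auto simp: ideal_rel_def refl_on_def)
  show "sym (ideal_rel S A N)"
  proof (rule symI)
    fix x y assume "(x, y) \<in> ideal_rel S A N"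
    then show "(y, x) \<in> ideal_rel S A N"
      using N(3)[of "x \<cdot> \<sim> y"] by (auto simp: ideal_rel_def)
  qed
  show "trans (ideal_rel S A N)"
  proof (rule transI)
    fix x y z assume "(x, y) \<in> ideal_rel S A N" "(y, z) \<in> ideal_rel S A N"
    then show "(x, z) \<in> ideal_rel S A N"
      using N(2)[of "x \<cdot> \<sim> y" "y \<cdot> \<sim> z"] by (auto simp: ideal_rel_def)
  qed
qed

text \<open>Compatibility of the relation with the operations makes every operation on classes
  independent of representatives, so identities can be checked on representatives and descend from
  \<open>A\<close>.\<close>

lemma quotient:
  assumes "congruence_ideal N"
  shows "in_variety S E (quot_alg S A N)"
    and "quot_map S A N \<in> hom S A (quot_alg S A N)"
    and "carrier (quot_alg S A N) = quot_map S A N ` carrier A"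
    and "ker S A (quot_alg S A N) (quot_map S A N) = N"
proof -
  let ?q = "quot_map S A N" and ?Q = "quot_alg S A N"
  have sub: "subalgebra S A N" using assms by (simp add: congruence_ideal_def)
  note eq = ideal_rel_equiv[OF sub]
  show car: "carrier ?Q = ?q ` carrier A"
    by (auto simp: quot_alg_def quotient_def quot_map_def)
  have q_eq: "?q x = ?q y \<longleftrightarrow> (x, y) \<in> ideal_rel S A N" if "x \<in> carrier A" "y \<in> carrier A" for x y
    using eq_equiv_class_iff[OF eq that] by (simp add: quot_map_def)
  have op: "?q (interp A f xs) = interp ?Q f (map ?q xs)"
    if len: "length xs = arity S f" and xs: "set xs \<subseteq> carrier A" for f xs
  proof -
    \<comment> \<open>Every choice of representatives gives the same class, so the union in
      \<open>quot_alg\<close> is over a single set.\<close>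
    have "?q (interp A f ys) = ?q (interp A f xs)" if "list_all2 (\<in>) ys (map ?q xs)" for ys
    proof -
      have "list_all2 (\<lambda>x y. (x, y) \<in> ideal_rel S A N) xs ys"
        using that by (auto simp: list_all2_conv_all_nth quot_map_def)
      then have "(interp A f xs, interp A f ys) \<in> ideal_rel S A N"
        using assms len by (auto simp: congruence_ideal_def)
      moreover from this have "interp A f xs \<in> carrier A" "interp A f ys \<in> carrier A"
        by (auto simp: ideal_rel_def)
      ultimately show ?thesis using q_eq by metis
    qed
    moreover have "list_all2 (\<in>) xs (map ?q xs)"
      using xs equiv_class_self[OF eq]
      by (auto simp: list_all2_conv_all_nth quot_map_def set_conv_nth)
    ultimately have "{?q (interp A f ys) | ys. list_all2 (\<in>) ys (map ?q xs)} = {?q (interp A f xs)}"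
      by blast
    then show ?thesis by (simp add: quot_alg_def)
  qed
  show hom: "?q \<in> hom S A ?Q" using car op by (auto simp: hom_def)
  have alg: "algebra S ?Q"
    using subalgebra_image[OF hom subalgebra_carrier] by (simp add: algebra_def subalgebra_def car)
  have "satisfies ?Q s t" if st: "(s, t) \<in> E" for s t unfolding satisfies_def
  proof (intro allI impI)
    fix c :: "nat \<Rightarrow> 'a set" assume "range c \<subseteq> carrier ?Q"
    then have "c i \<in> ?q ` carrier A" for i using car by blast
    then have "\<forall>i. \<exists>x. x \<in> carrier A \<and> c i = ?q x" by blast
    \<comment> \<open>A sequence of classes is lifted entrywise to a sequence of representatives, on
      which the identity holds in \<open>A\<close>.\<close>
    then obtain b where b: "\<And>i. b i \<in> carrier A \<and> c i = ?q (b i)" by metis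
    then have rb: "range b \<subseteq> carrier A" and c: "c = ?q \<circ> b" by auto
    have wf: "wf_trm S s" "wf_trm S t" using identities st by (auto simp: identities_over_def)
    have "satisfies A s t" using in_variety st by (auto simp: in_variety_def)
    then have "eval A b s = eval A b t" using rb by (simp add: satisfies_def)
    then show "eval ?Q c s = eval ?Q c t"
      unfolding c using hom_eval[OF algebra hom rb] wf by metis
  qed
  then show "in_variety S E ?Q" using alg by (auto simp: in_variety_def)
  have "?q x = one_of S ?Q \<longleftrightarrow> x \<in> N" if "x \<in> carrier A" for x
    using q_eq[of x \<one>] that hom_ops(1)[OF hom] by (simp add: ideal_rel_def)
  moreover have "N \<subseteq> carrier A" using sub by (simp add: subalgebra_def)
  ultimately show "ker S A ?Q ?q = N" by (auto simp: ker_def)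
qed

text \<open>A kernel pair is a congruence; conversely, \<open>N\<close> is the kernel of the
  projection onto its quotient, which again lies in the variety.\<close>

lemma omega_ideal_iff: "omega_ideal S E A N \<longleftrightarrow> congruence_ideal N"
  using kernel_is_ideal[OF variety in_variety] quotient omega_ideal_imp_congruence_ideal by metis

text \<open>The relation of an intersection is the intersection of the relations, and compatibility
  with the operations is inherited by it. This is what makes the hull in the definition of the
  commutator an ideal.\<close>

lemma omega_ideal_Inter:
  assumes "\<F> \<noteq> {}" "\<And>N. N \<in> \<F> \<Longrightarrow> omega_ideal S E A N"
  shows "omega_ideal S E A (\<Inter>\<F>)"
proof -
  have rel: "(x, y) \<in> ideal_rel S A (\<Inter>\<F>) \<longleftrightarrow> (\<forall>N\<in>\<F>. (x, y) \<in> ideal_rel S A N)" for x y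
    using assms(1) by (auto simp: ideal_rel_def)
  have c: "congruence_ideal N" if "N \<in> \<F>" for N using assms(2) that omega_ideal_iff by auto
  have "subalgebra S A (\<Inter>\<F>)"
    using assms(1) c by (intro subalgebra_Inter) (auto simp: congruence_ideal_def)
  moreover have "(interp A f xs, interp A f ys) \<in> ideal_rel S A N"
    if "length xs = arity S f" "list_all2 (\<lambda>x y. (x, y) \<in> ideal_rel S A (\<Inter>\<F>)) xs ys" "N \<in> \<F>"
    for f xs ys N
  proof -
    have "list_all2 (\<lambda>x y. (x, y) \<in> ideal_rel S A N) xs ys"
      using that(2) by (rule list_all2_mono) (simp add: rel that(3))
    then show ?thesis using c[OF that(3)] that(1) by (simp add: congruence_ideal_def)
  qed
  ultimately show ?thesis by (simp add: omega_ideal_iff congruence_ideal_def rel)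
qed

lemma omega_ideal_carrier: "omega_ideal S E A (carrier A)"
proof -
  have "(x, y) \<in> ideal_rel S A (carrier A) \<longleftrightarrow> x \<in> carrier A \<and> y \<in> carrier A" for x y
    by (auto simp: ideal_rel_def)
  then show ?thesis
    using subalgebra_carrier
    by (auto simp: omega_ideal_iff congruence_ideal_def list_all2_conv_all_nth set_conv_nth
        intro!: interp_closed)
qed

lemma omega_ideal_one: "omega_ideal S E A {\<one>}"
proof -
  have "id \<in> hom S A A" by (simp add: hom_def)
  moreover have "ker S A A id = {\<one>}" by (auto simp: ker_def)
  ultimately show ?thesis using kernel_is_ideal[OF variety in_variety in_variety] by metis
qed

text \<open>If \<open>N\<close> is the kernel of a homomorphism, the intersection is the kernel of
  its restriction to \<open>H\<close>.\<close>

lemma omega_ideal_restrict: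
  assumes "omega_ideal S E A N" "subalgebra S A H"
  shows "omega_ideal S E (subalg A H) (N \<inter> H)"
proof -
  have HA: "H \<subseteq> carrier A" using assms(2) by (simp add: subalgebra_def)
  obtain B :: "('f, 'a set) alg" and h where B: "in_variety S E B" and h: "h \<in> hom S A B"
    and N: "N = ker S A B h"
    using assms(1) by (auto simp: omega_ideal_def)
  have "h \<in> hom S (subalg A H) B" using h HA by (auto simp: hom_def)
  moreover have "ker S (subalg A H) B h = N \<inter> H" using HA by (auto simp: ker_def N)
  ultimately show ?thesis
    using kernel_is_ideal[OF variety in_variety_subalg[OF assms(2)] B] by metis
qed

text \<open>The hull is an intersection of subalgebras, over a family that contains
  \<open>carrier A\<close>.\<close>

lemma subalgebra_join:
  assumes "M \<subseteq> carrier A" "N \<subseteq> carrier A"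
  shows "subalgebra S A (join S A M N)"
  unfolding join_def hull_def using assms subalgebra_carrier
  by (intro subalgebra_Inter) blast+

lemma omega_group_join:
  assumes "M \<subseteq> carrier A" "N \<subseteq> carrier A"
  shows "omega_group S E (subalg A (join S A M N))"
  using variety in_variety_subalg[OF subalgebra_join[OF assms]] by unfold_locales

section \<open>The commutator as an ideal of the join, and its triviality\<close>

lemma commutator_gens_closed:
  assumes H: "subalgebra S A H" and MN: "M \<subseteq> H" "N \<subseteq> H"
  shows "commutator_gens S EB A M N \<subseteq> H"
proof -
  note c = subalgebra_closed[OF H]
  have "eval A (\<lambda>i. m i \<cdot> n i) v \<cdot> \<sim> (eval A n v) \<cdot> \<sim> (eval A m v) \<in> H"
    if "wf_trm S v" "range m \<subseteq> M" "range n \<subseteq> N" for v m n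
  proof -
    have "range m \<subseteq> H" "range n \<subseteq> H" using that MN by auto
    moreover from this have "range (\<lambda>i. m i \<cdot> n i) \<subseteq> H" using c(2) by auto
    ultimately show ?thesis using that c eval_in_sub[OF H] by simp
  qed
  moreover have "eval A p v \<in> H" if "wf_trm S v" "range p \<subseteq> M \<inter> N" for v p
    using that MN eval_in_sub[OF H] by blast
  ultimately show ?thesis by (auto simp: commutator_gens_def trivial_terms_def)
qed

text \<open>The hull is an intersection of ideals of the join. The family is non-empty because the
  join is an ideal of itself and contains the generators.\<close>

lemma omega_ideal_commutator:
  assumes "M \<subseteq> carrier A" "N \<subseteq> carrier A"
  shows "omega_ideal S E (subalg A (join S A M N)) (commutator S E EB A M N)"
proof -
  interpret H: omega_group S E "subalg A (join S A M N)" by (rule omega_group_join[OF assms])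
  have "commutator_gens S EB A M N \<subseteq> join S A M N"
    by (intro commutator_gens_closed subalgebra_join join_upper assms)
  then show ?thesis
    unfolding commutator_def hull_def using H.omega_ideal_carrier
    by (intro H.omega_ideal_Inter) auto
qed

text \<open>Since the unit subalgebra is an ideal of the join, a set of generators inside it
  generates nothing more. From here on triviality of commutators is tested on generators.\<close>

lemma commutator_trivial_iff:
  assumes "M \<subseteq> carrier A" "N \<subseteq> carrier A"
  shows "commutator S E EB A M N = {\<one>} \<longleftrightarrow> commutator_gens S EB A M N \<subseteq> {\<one>}"
proof
  assume "commutator S E EB A M N = {\<one>}"
  then show "commutator_gens S EB A M N \<subseteq> {\<one>}"
    using commutator_gens_subset_commutator by metis
next
  interpret H: omega_group S E "subalg A (join S A M N)" by (rule omega_group_join[OF assms])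
  assume "commutator_gens S EB A M N \<subseteq> {\<one>}"
  then have "commutator S E EB A M N \<subseteq> {\<one>}"
    using commutator_least[OF H.omega_ideal_one] by simp
  moreover have "\<one> \<in> commutator S E EB A M N"
    using H.subalgebra_closed(1) omega_ideal_commutator[OF assms] by (simp add: omega_ideal_def)
  ultimately show "commutator S E EB A M N = {\<one>}" by blast
qed


section \<open>Normal subalgebras and symmetry in the case of trivial generators\<close>

definition normal :: "'a set \<Rightarrow> bool" where
  "normal N \<longleftrightarrow> subalgebra S A N \<and> (\<forall>x\<in>N. \<forall>g\<in>carrier A. g \<cdot> x \<cdot> \<sim> g \<in> N)"

lemma normalD:
  assumes "normal N"
  shows "subalgebra S A N" "N \<subseteq> carrier A" "\<one> \<in> N" "x \<in> N \<Longrightarrow> \<sim> x \<in> N"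
    "x \<in> N \<Longrightarrow> y \<in> N \<Longrightarrow> x \<cdot> y \<in> N" "x \<in> N \<Longrightarrow> g \<in> carrier A \<Longrightarrow> g \<cdot> x \<cdot> \<sim> g \<in> N"
proof -
  show N: "subalgebra S A N" and "x \<in> N \<Longrightarrow> g \<in> carrier A \<Longrightarrow> g \<cdot> x \<cdot> \<sim> g \<in> N"
    using assms by (simp_all add: normal_def del: assoc)
  then show "N \<subseteq> carrier A" by (simp add: subalgebra_def)
qed (use assms subalgebra_closed in \<open>simp_all add: normal_def\<close>)

text \<open>Closure under the operations and under conjugation is all that the symmetry argument
  asks of \<open>M\<close> and \<open>N\<close>.\<close>

lemma omega_ideal_normal:
  assumes "omega_ideal S E A N"
  shows "normal N"
proof -
  obtain B :: "('f, 'a set) alg" and h where B: "omega_group S E B" and h: "h \<in> hom S A B"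
    and N: "N = {a \<in> carrier A. h a = one_of S B}"
    by (rule omega_ideal_kernel[OF assms])
  interpret B: omega_group S E B by (rule B)
  have "subalgebra S A N" using assms by (simp add: omega_ideal_def)
  then show ?thesis using hom_ops[OF h] by (auto simp: normal_def N)
qed

text \<open>By surjectivity of \<open>h\<close>, every conjugating element of \<open>B\<close> lifts
  to \<open>A\<close>, so each conjugate of an image is the image of a conjugate. This provides
  normality of direct images without showing them to be kernels.\<close>

lemma normal_image:
  assumes B: "omega_group S E B" and h: "h \<in> hom S A B" "carrier B = h ` carrier A"
    and N: "normal N"
  shows "omega_group.normal S B (h ` N)"
proof -
  interpret B: omega_group S E B by (rule B)
  note NA = normalD(2)[OF N]
  have "mult_of S B (mult_of S B (h g) (h x)) (inv_of S B (h g)) \<in> h ` N"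
    if "x \<in> N" "g \<in> carrier A" for x g
  proof -
    have "h (g \<cdot> x \<cdot> \<sim> g) \<in> h ` N" using normalD(6)[OF N] that by blast
    moreover have "x \<in> carrier A" using NA that by auto
    ultimately show ?thesis using that(2) by (simp add: hom_ops[OF h(1)] del: assoc)
  qed
  then show ?thesis
    using subalgebra_image[OF h(1) normalD(1)[OF N]] h(2) by (auto simp: B.normal_def)
qed

lemma commutator_gen_eq_one_iff:
  assumes "M \<subseteq> carrier A" "N \<subseteq> carrier A" "v \<in> trivial_terms S EB" "range m \<subseteq> M" "range n \<subseteq> N"
  shows "eval A (\<lambda>i. m i \<cdot> n i) v \<cdot> \<sim> (eval A n v) \<cdot> \<sim> (eval A m v) = \<one> \<longleftrightarrow>
     eval A (\<lambda>i. m i \<cdot> n i) v = eval A m v \<cdot> eval A n v"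
proof -
  have "range m \<subseteq> carrier A" "range n \<subseteq> carrier A" using assms by auto
  moreover from this have "range (\<lambda>i. m i \<cdot> n i) \<subseteq> carrier A" by auto
  ultimately show ?thesis
    using assms(3) by (intro mult_inv_inv_eq_one_iff) (auto simp: trivial_terms_def)
qed

lemma commutator_gens_trivialD:
  assumes triv: "commutator_gens S EB A M N \<subseteq> {\<one>}" and v: "v \<in> trivial_terms S EB"
  shows "M \<subseteq> carrier A \<Longrightarrow> N \<subseteq> carrier A \<Longrightarrow> range m \<subseteq> M \<Longrightarrow> range n \<subseteq> N \<Longrightarrow>
      eval A (\<lambda>i. m i \<cdot> n i) v = eval A m v \<cdot> eval A n v"
    and "range p \<subseteq> M \<inter> N \<Longrightarrow> eval A p v = \<one>"
  using subsetD[OF triv commutator_gensI(1)[OF v, of m M n N]]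
    commutator_gen_eq_one_iff[OF _ _ v, of M N m n]
    subsetD[OF triv commutator_gensI(2)[OF v, of p M N]]
  unfolding singleton_iff by iprover+

lemma commutator_gens_trivialI:
  assumes MNA: "M \<subseteq> carrier A" "N \<subseteq> carrier A"
    and mult: "\<And>v m n. v \<in> trivial_terms S EB \<Longrightarrow> range m \<subseteq> M \<Longrightarrow> range n \<subseteq> N \<Longrightarrow>
      eval A (\<lambda>i. m i \<cdot> n i) v = eval A m v \<cdot> eval A n v"
    and int: "\<And>v p. v \<in> trivial_terms S EB \<Longrightarrow> range p \<subseteq> M \<inter> N \<Longrightarrow> eval A p v = \<one>"
  shows "commutator_gens S EB A M N \<subseteq> {\<one>}"
proof
  fix x assume "x \<in> commutator_gens S EB A M N"
  then show "x \<in> {\<one>}"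
  proof (cases rule: commutator_gensE)
    case (mult v m n)
    then show ?thesis
      using commutator_gen_eq_one_iff[OF MNA mult(1-3)] assms(3)[OF mult(1-3)]
      by (simp only: singleton_iff)
  next
    case (int v p)
    then show ?thesis using assms(4) by (simp only: singleton_iff)
  qed
qed

text \<open>Makes the group laws available in the test algebras of \<open>trivial_terms\<close>, as
  is needed to show that a given term belongs to W.\<close>

lemma subvariety_omega_group:
  assumes "subvariety S EB E" "in_variety S EB (B :: ('f, 'f trm set) alg)"
  shows "omega_group S E B"
proof
  show "in_variety S E B" using assms unfolding subvariety_def by blast
qed (rule variety)

lemma eval_mult: "eval B b (App (mult_sym S) [s, t]) = mult_of S B (eval B b s) (eval B b t)"
  by (simp add: mult_of_def)

lemma eval_inv: "eval B b (App (inv_sym S) [t]) = inv_of S B (eval B b t)"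
  by (simp add: inv_of_def)

text \<open>The term is z v z^{-1} with z = \<open>Var 0\<close>, new because the variables of
  \<open>v\<close> are shifted. In the subvariety \<open>v\<close> has value 1, which leaves z
  z^{-1} = 1.\<close>

lemma trivial_terms_conjugate:
  assumes "subvariety S EB E" "v \<in> trivial_terms S EB"
  shows "App (mult_sym S) [App (mult_sym S) [Var 0, rename Suc v], App (inv_sym S) [Var 0]]
    \<in> trivial_terms S EB" (is "?u \<in> _")
proof -
  have "eval B b ?u = one_of S B"
    if B: "in_variety S EB B" and b: "range b \<subseteq> carrier B" for B :: "('f, 'f trm set) alg" and b
  proof -
    interpret B: omega_group S E B by (rule subvariety_omega_group[OF assms(1) B])
    have "range (b \<circ> Suc) \<subseteq> carrier B" using b by auto
    then have "eval B (b \<circ> Suc) v = one_of S B"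
      using assms(2) B unfolding trivial_terms_def by blast
    moreover have "b 0 \<in> carrier B" using b by auto
    ultimately show ?thesis
      by (simp only: eval_mult eval_inv eval_rename eval.simps(1) B.units)
  qed
  then show ?thesis using assms(2) by (auto simp: trivial_terms_def)
qed


text \<open>Multiplicativity is applied to u = z v z^{-1} with the tuples (1, m) from
  \<open>M\<close> and (y, 1, 1, ...) from \<open>N\<close>, whose product is (y, m). The values of
  u are v(m), then y v(1) y^{-1} = 1, and y v(m) y^{-1} on the product; hence y v(m) y^{-1} =
  v(m).\<close>

lemma eval_conjugate:
  assumes v: "v \<in> trivial_terms S EB" and EB: "subvariety S EB E"
    and MN: "normal M" "normal N"
    and gens: "commutator_gens S EB A M N \<subseteq> {\<one>}"
    and m: "range m \<subseteq> M" and y: "y \<in> N"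
  shows "y \<cdot> eval A m v = eval A m v \<cdot> y"
proof -
  let ?u = "App (mult_sym S) [App (mult_sym S) [Var 0, rename Suc v], App (inv_sym S) [Var 0]]"
  \<comment> \<open>The entry at 0 is the value of the conjugating variable; the entries after it
    feed the shifted copy of \<open>v\<close>.\<close>
  let ?m = "case_nat \<one> m" and ?n = "case_nat y (\<lambda>_. \<one>)"
  have MNA: "M \<subseteq> carrier A" "N \<subseteq> carrier A" using MN by (auto dest: normalD)
  have wf: "wf_trm S v" using v by (simp add: trivial_terms_def)
  have mA: "m i \<in> carrier A" for i using m MNA by auto
  have yA: "y \<in> carrier A" using y MNA by auto
  have vA: "eval A m v \<in> carrier A" using m MNA wf by auto
  have u: "eval A b ?u = b 0 \<cdot> eval A (b \<circ> Suc) v \<cdot> \<sim> b 0" for b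
    by (simp only: eval_mult eval_inv eval_rename eval.simps(1))
  have "m i \<in> M" for i using m by auto
  then have "range ?m \<subseteq> M" "range ?n \<subseteq> N"
    using y normalD(3)[OF MN(1)] normalD(3)[OF MN(2)] by (auto split: nat.split)
  then have "eval A (\<lambda>i. ?m i \<cdot> ?n i) ?u = eval A ?m ?u \<cdot> eval A ?n ?u"
    by (rule commutator_gens_trivialD(1)[OF gens trivial_terms_conjugate[OF EB v] MNA])
  moreover have "(\<lambda>i. ?m i \<cdot> ?n i) \<circ> Suc = m" "?m \<circ> Suc = m" "?n \<circ> Suc = (\<lambda>_. \<one>)"
    using mA by auto
  ultimately have conj: "y \<cdot> eval A m v \<cdot> \<sim> y = eval A m v"
    unfolding u using yA vA wf by simp
  have "y \<cdot> eval A m v = y \<cdot> eval A m v \<cdot> \<sim> y \<cdot> y" using yA vA by simp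
  also have "\<dots> = eval A m v \<cdot> y" by (simp only: conj)
  finally show ?thesis .
qed

lemma commutator_gens_commute:
  assumes EB: "subvariety S EB E" and MN: "normal M" "normal N"
    and gens: "commutator_gens S EB A M N \<subseteq> {\<one>}"
  shows "commutator_gens S EB A N M \<subseteq> {\<one>}"
proof -
  have MNA: "M \<subseteq> carrier A" "N \<subseteq> carrier A" using MN by (auto dest: normalD)
  note triv = commutator_gens_trivialD[OF gens]
  have "eval A (\<lambda>i. n i \<cdot> m i) v = eval A n v \<cdot> eval A m v"
    if v: "v \<in> trivial_terms S EB" and n: "range n \<subseteq> N" and m: "range m \<subseteq> M" for v m n
  proof -
    have mM: "m i \<in> M" and nN: "n i \<in> N" for i using m n by auto
    have mA: "m i \<in> carrier A" and nA: "n i \<in> carrier A" for i using mM nN MNA by auto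
    \<comment> \<open>Moving n past m gives nm = m'n with m' the conjugate of m, still in
      \<open>M\<close>; and m' = mr defines the correction r.\<close>
    define m' where "m' i = n i \<cdot> m i \<cdot> \<sim> n i" for i
    define r where "r i = \<sim> m i \<cdot> m' i" for i
    have m'M: "m' i \<in> M" for i unfolding m'_def by (rule normalD(6)[OF MN(1) mM nA])
    have rM: "r i \<in> M" for i unfolding r_def by (intro normalD(4,5)[OF MN(1)] m'M mM)
    \<comment> \<open>Regrouped, r is the conjugate of n by m^{-1}, times n^{-1}. This puts r in
      \<open>N\<close>, whereas its definition puts it in \<open>M\<close>.\<close>
    have "r i = \<sim> m i \<cdot> n i \<cdot> \<sim> (\<sim> m i) \<cdot> \<sim> n i" for i
      using mA nA by (simp add: r_def m'_def)
    moreover have "\<sim> m i \<cdot> n i \<cdot> \<sim> (\<sim> m i) \<cdot> \<sim> n i \<in> N" for i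
      by (intro normalD(4,5,6)[OF MN(2)] nN closed mA)
    ultimately have r: "range r \<subseteq> M \<inter> N" using rM by auto
    have wf: "wf_trm S v" using v by (simp add: trivial_terms_def)
    have "eval A (\<lambda>i. n i \<cdot> m i) v = eval A (\<lambda>i. m' i \<cdot> n i) v"
      using mA nA by (simp add: m'_def)
    also have "\<dots> = eval A m' v \<cdot> eval A n v" 
      using m'M by (intro triv(1)[OF v MNA _ n]) auto
    also have "m' = (\<lambda>i. m i \<cdot> r i)" using mA nA by (simp add: r_def m'_def fun_eq_iff)
    also have "eval A (\<lambda>i. m i \<cdot> r i) v = eval A m v \<cdot> eval A r v" 
      using r by (intro triv(1)[OF v MNA m]) auto
    \<comment> \<open>Here v(r) = 1, a generator of the second kind, because r has its entries in
      the intersection.\<close>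
    also have "\<dots> = eval A m v" using triv(2)[OF v r] mA wf m MNA by auto
    \<comment> \<open>As \<open>N\<close> is a subalgebra, v(n) is an element of \<open>N\<close>,
      so v(m) commutes with it.\<close>
    also have "eval A m v \<cdot> eval A n v = eval A n v \<cdot> eval A m v"
      using eval_conjugate[OF v EB MN gens m eval_in_sub[OF normalD(1)[OF MN(2)] wf n]] by simp
    finally show ?thesis .
  qed
  then show ?thesis
    using triv(2) by (intro commutator_gens_trivialI MNA) (simp_all only: Int_commute[of N M])
qed

section \<open>Bounds, monotonicity and the commutator of the whole algebra\<close>

lemma commutator_gen_in_ideal:
  assumes I: "omega_ideal S E A I" and m: "range m \<subseteq> carrier A" and n: "range n \<subseteq> carrier A"
    and v: "wf_trm S v" and mn: "range m \<subseteq> I \<or> range n \<subseteq> I"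
  shows "eval A (\<lambda>i. m i \<cdot> n i) v \<cdot> \<sim> (eval A n v) \<cdot> \<sim> (eval A m v) \<in> I" (is "?g \<in> I")
proof -
  obtain B :: "('f, 'a set) alg" and h where B: "omega_group S E B" and h: "h \<in> hom S A B"
    and I: "I = {a \<in> carrier A. h a = one_of S B}"
    by (rule omega_ideal_kernel[OF I])
  interpret B: omega_group S E B by (rule B)
  have mnA: "m i \<in> carrier A" "n i \<in> carrier A" for i using m n by auto
  then have "range (\<lambda>i. m i \<cdot> n i) \<subseteq> carrier A" by auto
  then have "?g \<in> carrier A" using m n v by simp
  moreover have hB: "h (m i) \<in> carrier B" "h (n i) \<in> carrier B" for i
    using hom_ops(4)[OF h] mnA by auto
  then have r: "range (h \<circ> m) \<subseteq> carrier B" "range (h \<circ> n) \<subseteq> carrier B" by auto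
  \<comment> \<open>Modulo the ideal one of the two tuples is constantly 1, where \<open>v\<close>
    has value 1; the other tuple then contributes its value together with the inverse of that
    value.\<close>
  have "h ?g = one_of S B"
    using mn
  proof
    assume "range m \<subseteq> I"
    then have hm: "h (m i) = one_of S B" for i using I by auto
    then have "h \<circ> m = (\<lambda>_. one_of S B)" by auto
    moreover have "(\<lambda>i. mult_of S B (h (m i)) (h (n i))) = h \<circ> n" using hm hB by auto
    ultimately show ?thesis
      unfolding hom_commutator_gen[OF h m n v] using v r by (simp del: B.assoc)
  next
    assume "range n \<subseteq> I"
    then have hn: "h (n i) = one_of S B" for i using I by auto
    then have "h \<circ> n = (\<lambda>_. one_of S B)" by auto
    moreover have "(\<lambda>i. mult_of S B (h (m i)) (h (n i))) = h \<circ> m" using hn hB by auto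
    ultimately show ?thesis
      unfolding hom_commutator_gen[OF h m n v] using v r by (simp del: B.assoc)
  qed
  ultimately show ?thesis by (simp add: I)
qed

lemma commutator_gens_subset_Int:
  assumes M: "omega_ideal S E A M" and N: "omega_ideal S E A N"
  shows "commutator_gens S EB A M N \<subseteq> M \<inter> N"
proof -
  have sub: "subalgebra S A M" "subalgebra S A N" using M N by (auto simp: omega_ideal_def)
  then have MNA: "M \<subseteq> carrier A" "N \<subseteq> carrier A" by (auto simp: subalgebra_def)
  have gen_mem: "eval A (\<lambda>i. m i \<cdot> n i) v \<cdot> \<sim> (eval A n v) \<cdot> \<sim> (eval A m v) \<in> M \<inter> N"
    if "wf_trm S v" "range m \<subseteq> M" "range n \<subseteq> N" for v m n
  proof -
    have "range m \<subseteq> carrier A" "range n \<subseteq> carrier A" using that MNA by auto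
    then show ?thesis
      using that by (intro IntI commutator_gen_in_ideal M N) simp_all
  qed
  have eval_mem: "eval A p v \<in> M \<inter> N" if "wf_trm S v" "range p \<subseteq> M \<inter> N" for v p
    using that eval_in_sub[OF sub(1)] eval_in_sub[OF sub(2)] by blast
  show ?thesis
  proof
    show "x \<in> M \<inter> N" if "x \<in> commutator_gens S EB A M N" for x
      using that
    proof (cases rule: commutator_gensE)
      case (mult v m n)
      have "wf_trm S v" using mult(1) by (simp add: trivial_terms_def)
      from gen_mem[OF this mult(2,3)] show ?thesis unfolding mult(4) .
    next
      case (int v p)
      have "wf_trm S v" using int(1) by (simp add: trivial_terms_def)
      from eval_mem[OF this int(2)] show ?thesis unfolding int(3) .
    qed
  qed
qed

text \<open>The intersection is an ideal of \<open>A\<close> inside the join, hence an ideal of the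
  join, and it contains all generators.\<close>

lemma commutator_subset_Int:
  assumes M: "omega_ideal S E A M" and N: "omega_ideal S E A N"
  shows "commutator S E EB A M N \<subseteq> M \<inter> N"
proof -
  have "M \<subseteq> carrier A" "N \<subseteq> carrier A"
    using M N by (auto simp: omega_ideal_def subalgebra_def)
  then have "omega_ideal S E (subalg A (join S A M N)) (\<Inter>{M, N} \<inter> join S A M N)"
    using M N by (intro omega_ideal_restrict omega_ideal_Inter subalgebra_join) auto
  moreover have "\<Inter>{M, N} \<inter> join S A M N = M \<inter> N" using join_upper(1)[of M S A N] by auto
  ultimately show ?thesis
    using commutator_gens_subset_Int[OF M N] by (intro commutator_least) simp_all
qed

text \<open>The two commutators are ideals of different joins. The larger one has to be cut down to
  the smaller join before minimality of the smaller one applies.\<close>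

lemma commutator_mono:
  assumes MNA: "M \<subseteq> carrier A" "N' \<subseteq> carrier A" and N: "N \<subseteq> N'"
  shows "commutator S E EB A M N \<subseteq> commutator S E EB A M N'"
proof -
  let ?H = "join S A M N" and ?H' = "join S A M N'"
  have NA: "N \<subseteq> carrier A" using N MNA(2) by (rule order_trans)
  interpret H': omega_group S E "subalg A ?H'" by (rule omega_group_join[OF MNA])
  have H: "subalgebra S A ?H" by (rule subalgebra_join[OF MNA(1) NA])
  have "?H \<subseteq> ?H'"
    using join_upper[of M S A N'] join_upper[of N' S A M] N
    by (intro join_least subalgebra_join MNA) (auto simp: join_commute)
  then have "subalgebra S (subalg A ?H') ?H" using H by (simp add: subalgebra_def)
  from H'.omega_ideal_restrict[OF omega_ideal_commutator[OF MNA] this]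
  have "omega_ideal S E (subalg A ?H) (commutator S E EB A M N' \<inter> ?H)" by simp
  moreover have "commutator_gens S EB A M N \<subseteq> commutator S E EB A M N' \<inter> ?H"
    using order_trans[OF commutator_gens_mono[OF order_refl N] commutator_gens_subset_commutator]
      commutator_gens_closed[OF H join_upper] by (rule Int_greatest)
  ultimately have "commutator S E EB A M N \<subseteq> commutator S E EB A M N' \<inter> ?H"
    by (rule commutator_least)
  then show ?thesis by (rule order_trans) (rule Int_lower1)
qed

text \<open>For membership in the subvariety, each of its identities s = t is turned into the term s
  t^{-1} of W. With both ideals equal to \<open>A\<close> the intersection is \<open>A\<close>, so
  the generators of the second kind make this term vanish on all of \<open>A\<close>.\<close>

lemma commutator_self_trivial_iff:
  assumes EB: "subvariety S EB E"
  shows "commutator S E EB A (carrier A) (carrier A) = {\<one>} \<longleftrightarrow> in_variety S EB A"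
  unfolding commutator_trivial_iff[OF order_refl order_refl]
proof
  assume A: "in_variety S EB A"
  have ev: "eval A b v = \<one>" if "v \<in> trivial_terms S EB" "range b \<subseteq> carrier A" for v b
    using trivial_terms_any_type[OF _ _ that(1) A that(2)] EB by (simp add: subvariety_def)
  show "commutator_gens S EB A (carrier A) (carrier A) \<subseteq> {\<one>}"
  proof (rule commutator_gens_trivialI)
    fix v and m n :: "nat \<Rightarrow> 'a"
    assume v: "v \<in> trivial_terms S EB" and mn: "range m \<subseteq> carrier A" "range n \<subseteq> carrier A"
    then have "range (\<lambda>i. m i \<cdot> n i) \<subseteq> carrier A" by auto
    then show "eval A (\<lambda>i. m i \<cdot> n i) v = eval A m v \<cdot> eval A n v" using ev[OF v] mn by simp
  qed (simp_all add: ev)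
next
  assume triv: "commutator_gens S EB A (carrier A) (carrier A) \<subseteq> {\<one>}"
  have "satisfies A s t" if st: "(s, t) \<in> EB" for s t unfolding satisfies_def
  proof (intro allI impI)
    fix b :: "nat \<Rightarrow> 'a" assume b: "range b \<subseteq> carrier A"
    let ?v = "App (mult_sym S) [s, App (inv_sym S) [t]]"
    have wf: "wf_trm S s" "wf_trm S t"
      using EB st by (auto simp: subvariety_def identities_over_def)
    have "eval B c ?v = one_of S B"
      if B: "in_variety S EB B" and c: "range c \<subseteq> carrier B" for B :: "('f, 'f trm set) alg" and c
    proof -
      interpret B: omega_group S E B by (rule subvariety_omega_group[OF EB B])
      have "eval B c s = eval B c t"
        using B c st by (auto simp: in_variety_def satisfies_def)
      then show ?thesis
        using B.eval_closed[OF c wf(2)] by (simp only: eval_mult eval_inv B.units)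
    qed
    then have "?v \<in> trivial_terms S EB" using wf by (simp add: trivial_terms_def)
    then have "eval A b ?v = \<one>"
      using b by (intro commutator_gens_trivialD(2)[OF triv]) auto
    then have "eval A b s \<cdot> \<sim> (eval A b t) = \<one>" by (simp only: eval_mult eval_inv)
    then show "eval A b s = eval A b t" using mult_inv_eq_one_iff wf b by simp
  qed
  then show "in_variety S EB A" using algebra by (auto simp: in_variety_def)
qed

section \<open>Quotients, the universal property and symmetry\<close>

lemma omega_group_quotient:
  assumes "omega_ideal S E A I"
  shows "omega_group S E (quot_alg S A I)"
  using variety assms by unfold_locales (simp_all add: omega_ideal_iff quotient(1))

text \<open>The projection sends generators to generators for the direct images. If the latter are
  trivial, the former lie in its kernel, which is \<open>I\<close>.\<close>

lemma quotient_gens_trivialD: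
  assumes I: "omega_ideal S E A I" and MNA: "M \<subseteq> carrier A" "N \<subseteq> carrier A"
    and triv: "commutator_gens S EB (quot_alg S A I) (quot_map S A I ` M) (quot_map S A I ` N)
      \<subseteq> {one_of S (quot_alg S A I)}"
  shows "commutator_gens S EB A M N \<subseteq> I"
proof -
  let ?q = "quot_map S A I" and ?Q = "quot_alg S A I"
  note q = quotient[OF I[unfolded omega_ideal_iff]]
  have gens: "commutator_gens S EB A M N \<subseteq> carrier A"
    by (rule commutator_gens_closed[OF subalgebra_carrier MNA])
  have "?q x \<in> commutator_gens S EB ?Q (?q ` M) (?q ` N)"
    if "x \<in> commutator_gens S EB A M N" for x
    using that
  proof (cases rule: commutator_gensE)
    case (mult v m n)
    have "range m \<subseteq> carrier A" "range n \<subseteq> carrier A" "wf_trm S v"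
      using mult MNA by (auto simp: trivial_terms_def)
    note e = hom_commutator_gen[OF q(2) this]
    have "range (?q \<circ> m) \<subseteq> ?q ` M" "range (?q \<circ> n) \<subseteq> ?q ` N" using mult by auto
    from commutator_gensI(1)[OF mult(1) this] show ?thesis
      unfolding mult(4) e by (simp add: comp_def)
  next
    case (int v p)
    have "range p \<subseteq> carrier A" using int MNA by auto
    then have "?q x = eval ?Q (?q \<circ> p) v"
      using int hom_eval[OF algebra q(2)] by (simp add: trivial_terms_def)
    moreover have "range (?q \<circ> p) \<subseteq> ?q ` M \<inter> ?q ` N" using int by auto
    ultimately show ?thesis using commutator_gensI(2)[OF int(1)] by metis
  qed
  then have "x \<in> ker S A ?Q ?q" if "x \<in> commutator_gens S EB A M N" for x
    using that gens triv by (auto simp: ker_def)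
  then show ?thesis using q(4) by auto
qed

text \<open>Each generator for the direct images has to be lifted to a generator for
  \<open>M\<close> and \<open>N\<close>. For the first kind both tuples lift separately; for the
  second kind one lift must serve both sets, and this is where \<open>I\<close> contained in
  \<open>N\<close> enters.\<close>

lemma quotient_gens_trivialI:
  assumes I: "omega_ideal S E A I" and M: "M \<subseteq> carrier A" and N: "subalgebra S A N"
    and sub: "I \<subseteq> N" "commutator_gens S EB A M N \<subseteq> I"
  shows "commutator_gens S EB (quot_alg S A I) (quot_map S A I ` M) (quot_map S A I ` N)
      \<subseteq> {one_of S (quot_alg S A I)}"
proof -
  let ?q = "quot_map S A I" and ?Q = "quot_alg S A I"
  note q = quotient[OF I[unfolded omega_ideal_iff]]
  interpret Q: omega_group S E ?Q by (rule omega_group_quotient[OF I])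
  have NA: "N \<subseteq> carrier A" using N by (simp add: subalgebra_def)
  have one: "?q x = one_of S ?Q" if "x \<in> commutator_gens S EB A M N" for x
    using that sub(2) q(4) by (auto simp: ker_def)
  have lift: "\<exists>b. range b \<subseteq> K \<and> c = ?q \<circ> b" if c: "range c \<subseteq> ?q ` K" for c :: "nat \<Rightarrow> 'a set" and K
  proof -
    have "c i \<in> ?q ` K" for i using c by auto
    then have "\<forall>i. \<exists>x. x \<in> K \<and> c i = ?q x" by blast
    then obtain b where "\<forall>i. b i \<in> K \<and> c i = ?q (b i)" by metis
    then show ?thesis by (intro exI[of _ b]) auto
  qed
  have gen: "mult_of S ?Q (mult_of S ?Q (eval ?Q (\<lambda>i. mult_of S ?Q (m' i) (n' i)) v)
      (inv_of S ?Q (eval ?Q n' v))) (inv_of S ?Q (eval ?Q m' v)) = one_of S ?Q"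
    if v: "v \<in> trivial_terms S EB" and m': "range m' \<subseteq> ?q ` M" and n': "range n' \<subseteq> ?q ` N"
    for v m' n'
  proof -
    obtain m n where m: "range m \<subseteq> M" "m' = ?q \<circ> m" and n: "range n \<subseteq> N" "n' = ?q \<circ> n"
      using lift[OF m'] lift[OF n'] by blast
    have "range m \<subseteq> carrier A" "range n \<subseteq> carrier A" "wf_trm S v"
      using m n M NA v by (auto simp: trivial_terms_def)
    note e = hom_commutator_gen[OF q(2) this]
    have "eval A (\<lambda>i. m i \<cdot> n i) v \<cdot> \<sim> (eval A n v) \<cdot> \<sim> (eval A m v) \<in> commutator_gens S EB A M N"
      using commutator_gensI(1) v m(1) n(1) .
    from one[OF this] show ?thesis unfolding e m n comp_apply .
  qed
  have int: "eval ?Q p' v = one_of S ?Q"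
    if v: "v \<in> trivial_terms S EB" and p': "range p' \<subseteq> ?q ` M \<inter> ?q ` N" for v p'
  proof -
    obtain p where p: "range p \<subseteq> M" "p' = ?q \<circ> p" using p' lift[of p' M] by blast
    have pA: "range p \<subseteq> carrier A" using p M by auto
    \<comment> \<open>The lift chosen in \<open>M\<close> differs from some element of
      \<open>N\<close> by a factor in \<open>I\<close>, hence lies in \<open>N\<close>
      itself.\<close>
    have "p i \<in> N" for i
    proof -
      have "?q (p i) \<in> ?q ` N" using p' p(2) by auto
      then obtain n where n: "n \<in> N" "?q (p i) = ?q n" by auto
      have c: "p i \<in> carrier A" "n \<in> carrier A" using pA n NA by auto
      have "?q (p i \<cdot> \<sim> n) = one_of S ?Q"
        using c n(2) hom_ops[OF q(2)] by simp
      then have "p i \<cdot> \<sim> n \<in> N" using c q(4) sub(1) by (auto simp: ker_def)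
      then have "p i \<cdot> \<sim> n \<cdot> n \<in> N" using subalgebra_closed(2)[OF N] n by blast
      then show ?thesis using c by simp
    qed
    then have "range p \<subseteq> M \<inter> N" using p by auto
    then have "eval A p v \<in> commutator_gens S EB A M N" by (rule commutator_gensI(2)[OF v])
    from one[OF this] show ?thesis
      using hom_eval[OF algebra q(2) pA] v p(2) by (simp add: trivial_terms_def)
  qed
  show ?thesis
  proof
    show "x \<in> {one_of S ?Q}" if "x \<in> commutator_gens S EB ?Q (?q ` M) (?q ` N)" for x
      using that by (cases rule: commutator_gensE) (use gen int in auto)
  qed
qed

context
  fixes EB :: "'f identities" and M N :: "'a set"
  assumes M: "omega_ideal S E A M" and N: "omega_ideal S E A N"
begin

private abbreviation "H \<equiv> subalg A (join S A M N)"

lemma ideals_sub: "subalgebra S A M" "subalgebra S A N" "M \<subseteq> carrier A" "N \<subseteq> carrier A"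
  using M N by (auto simp: omega_ideal_def subalgebra_def)

lemma sub_join: "M \<subseteq> join S A M N" "N \<subseteq> join S A M N"
  by (rule join_upper)+

private abbreviation "trivial_image_gens I \<equiv>
  commutator_gens S EB (quot_alg S H I) (quot_map S H I ` M) (quot_map S H I ` N)
    \<subseteq> {one_of S (quot_alg S H I)}"

lemma trivial_image_iff:
  assumes I: "omega_ideal S E H I"
  shows "commutator S E EB (quot_alg S H I) (quot_map S H I ` M) (quot_map S H I ` N)
      = {one_of S (quot_alg S H I)} \<longleftrightarrow> trivial_image_gens I"
proof -
  interpret H: omega_group S E H by (rule omega_group_join[OF ideals_sub(3,4)])
  interpret Q: omega_group S E "quot_alg S H I" by (rule H.omega_group_quotient[OF I])
  show ?thesis
    using H.quotient(3)[OF I[unfolded H.omega_ideal_iff]] sub_join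
    by (intro Q.commutator_trivial_iff) auto
qed

text \<open>The commutator lies in \<open>N\<close> by \<open>commutator_subset_Int\<close>, which
  is the condition for lifting the intersection of the direct images.\<close>

lemma trivial_image_commutator: "trivial_image_gens (commutator S E EB A M N)"
proof -
  interpret H: omega_group S E H by (rule omega_group_join[OF ideals_sub(3,4)])
  have "subalgebra S H N"
    using ideals_sub(2) sub_join(2) by (auto simp: subalgebra_def)
  moreover have "commutator S E EB A M N \<subseteq> N" using commutator_subset_Int[OF M N] by blast
  ultimately show ?thesis
    using sub_join(1) commutator_gens_subset_commutator
    by (intro H.quotient_gens_trivialI omega_ideal_commutator ideals_sub) simp_all
qed

text \<open>Triviality in the quotient puts the generators into \<open>I\<close>, and the commutator
  is the least ideal of the join containing them.\<close>

lemma commutator_least_trivial_image: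
  assumes I: "omega_ideal S E H I" and triv: "trivial_image_gens I"
  shows "commutator S E EB A M N \<subseteq> I"
proof -
  interpret H: omega_group S E H by (rule omega_group_join[OF ideals_sub(3,4)])
  show ?thesis
    using H.quotient_gens_trivialD[OF I _ _ triv] sub_join
    by (intro commutator_least[OF I]) simp
qed

end

text \<open>By minimality of [N,M] among ideals with trivial images, it suffices to see that [M,N]
  is such an ideal for the exchanged pair. In the quotient by [M,N] the generators are trivial in
  one order, hence in the other.\<close>

lemma commutator_commute_subset:
  assumes EB: "subvariety S EB E" and M: "omega_ideal S E A M" and N: "omega_ideal S E A N"
  shows "commutator S E EB A N M \<subseteq> commutator S E EB A M N"
proof -
  let ?H = "subalg A (join S A M N)" and ?C = "commutator S E EB A M N"
  let ?q = "quot_map S ?H ?C" and ?Q = "quot_alg S ?H ?C"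
  have MNA: "M \<subseteq> carrier A" "N \<subseteq> carrier A"
    using M N by (auto simp: omega_ideal_def subalgebra_def)
  interpret H: omega_group S E ?H by (rule omega_group_join[OF MNA])
  note C = omega_ideal_commutator[OF MNA, of EB]
  interpret Q: omega_group S E ?Q by (rule H.omega_group_quotient[OF C])
  note q = H.quotient[OF C[unfolded H.omega_ideal_iff]]
  \<comment> \<open>The ideals are given in \<open>A\<close>, but conjugation is needed in the join;
    restricting to the join changes neither \<open>M\<close> nor \<open>N\<close>.\<close>
  have "H.normal (K \<inter> join S A M N)" if "omega_ideal S E A K" for K
    using omega_ideal_restrict[OF that subalgebra_join[OF MNA]] by (rule H.omega_ideal_normal)
  from this[OF M] this[OF N] have "H.normal M" "H.normal N"
    using join_upper(1)[of M S A N] join_upper(2)[of N S A M] by (simp_all add: Int_absorb2)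
  then have "Q.normal (?q ` M)" "Q.normal (?q ` N)"
    using H.normal_image[OF Q.omega_group_axioms q(2,3)] by auto
  then have "commutator_gens S EB ?Q (?q ` N) (?q ` M) \<subseteq> {one_of S ?Q}"
    using Q.commutator_gens_commute[OF EB] trivial_image_commutator[OF M N] by blast
  then show ?thesis
    using C commutator_least_trivial_image[OF N M, of ?C] by (simp add: join_commute[of S A N M])
qed

end

theorem proposition1p2:
  fixes S :: "'f omega_sig" and EA EB :: "'f identities"
    and A :: "('f, 'a) alg" and M N N' :: "'a set"
  assumes "omega_group_variety S EA" and "subvariety S EB EA"
    and "in_variety S EA A"
    and "omega_ideal S EA A M" and "omega_ideal S EA A N" and "omega_ideal S EA A N'"
  shows "(commutator S EA EB A (carrier A) (carrier A) = {one_of S A} \<longleftrightarrow> in_variety S EB A)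
    \<and> commutator S EA EB A M N = commutator S EA EB A N M
    \<and> commutator S EA EB A M N \<subseteq> M \<inter> N
    \<and> (N \<subseteq> N' \<longrightarrow> commutator S EA EB A M N \<subseteq> commutator S EA EB A M N')
    \<and> (let H = subalg A (join S A M N);
           trivial_image = (\<lambda>I. commutator S EA EB (quot_alg S H I)
               (quot_map S H I ` M) (quot_map S H I ` N) = {one_of S (quot_alg S H I)})
       in omega_ideal S EA H (commutator S EA EB A M N)
        \<and> trivial_image (commutator S EA EB A M N)
        \<and> (\<forall>I. omega_ideal S EA H I \<and> trivial_image I \<longrightarrow> commutator S EA EB A M N \<subseteq> I))"
proof -
  interpret omega_group S EA A using assms(1,3) by unfold_locales
  note EB = assms(2) and M = assms(4) and N = assms(5)
  have MNA: "M \<subseteq> carrier A" "N \<subseteq> carrier A" "N' \<subseteq> carrier A"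
    using assms(4-6) by (auto simp: omega_ideal_def subalgebra_def)
  have "commutator S EA EB A M N = commutator S EA EB A N M"
    by (intro equalityI commutator_commute_subset EB M N)
  then show ?thesis
    unfolding Let_def
  proof (intro conjI allI impI, goal_cases)
    case 1
    show ?case by (rule commutator_self_trivial_iff[OF EB])
  next
    case 2
    then show ?case .
  next
    case 3
    show ?case by (rule commutator_subset_Int[OF M N])
  next
    case 4
    then show ?case by (intro commutator_mono MNA)
  next
    case 5
    show ?case by (rule omega_ideal_commutator[OF MNA(1,2)])
  next
    case 6
    show ?case
      unfolding trivial_image_iff[OF M N omega_ideal_commutator[OF MNA(1,2)]]
      by (rule trivial_image_commutator[OF M N])
  next
    case (7 I)
    note I = 7(2)[THEN conjunct1] and triv = 7(2)[THEN conjunct2]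
    show ?case
      using triv unfolding trivial_image_iff[OF M N I]
      by (rule commutator_least_trivial_image[OF M N I])
  qed
qed

end
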